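(* The Hadamard walk on $\ell^2(\mathbb{Z})\otimes\mathbb{C}^2$, i.e. the quantum walk with symbol $$A_k=\begin{pmatrix}e^{-ik}&0\\0&e^{ik}\end{pmatrix}\frac{1}{\sqrt2}\begin{pmatrix}1&1\\1&-1\end{pmatrix},\qquad k\in[-\pi,\pi],$$ cannot be obtained as the coarse-graining of a scalar quantum walk: there are no group $G$ with a subgroup $H\cong\mathbb{Z}$ of index $2$, scalar quantum walk $A'$ on $G$, choice of coset representatives, and $k$-independent unitary $2\times2$ matrix $U$ such that the coarse-graining $\mathcal{R}[A']$ of $A'$ with respect to $H$ has symbol $UA_kU^\dagger$.
   Context: For a discrete group $G$, $T$ denotes the right regular representation on $\ell^2(G)$, $T_g|x\rangle=|xg^{-1}\rangle$. A scalar quantum walk on $G$ is a unitary operator on $\ell^2(G)$ of the form $A'=\sum_{h\in S_+}z_hT_h$, where $S_+\subseteq G$ is a finite generating set of $G$ (every element of $G$ is a product of elements of $S_+$ and their inverses; $S_+$ need not be symmetric and may contain the identity) and all $z_h\in\mathbb{C}\setminus\{0\}$. Coarse-graining. Let $H=\langle a\rangle\cong\mathbb{Z}$ be a subgroup of index $2$ in $G$, with $G=Hc_1\cup Hc_2$ for coset representatives $c_1,c_2$. Let $U_H:\ell^2(G)\to\ell^2(H)\otimes\mathbb{C}^2$ be the unitary $U_H|xc_j\rangle=|x\rangle|j\rangle$ for $x\in H$, $j=1,2$, with $\{|1\rangle,|2\rangle\}$ the canonical basis of $\mathbb{C}^2$. The coarse-graining of $A'$ is $$\mathcal{R}[A']=U_HA'U_H^\dagger=\sum_{h\in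 S_+}\sum_{j=1,2}z_h\,T_{c_{\tau(h,j)}hc_j^{-1}}\otimes|\tau(h,j)\rangle\langle j|,$$ where $\tau(h,j)\in\{1,2\}$ is the index with $c_jh^{-1}\in Hc_{\tau(h,j)}$ and $T$ on the right-hand side is the right regular representation of $H$. It can be written as $\sum_{n}T_{a^n}\otimes A_{n}$ (finite sum, $A_n$ complex $2\times2$ matrices), and its symbol is $\sum_n e^{-ikn}A_n$. *)

theory Defs
  imports "HOL-Analysis.Analysis" "HOL-Algebra.Elementary_Groups"
begin

text \<open>\<open>ell2 X\<close> is the carrier of the Hilbert space \<open>\<ell>\<^sup>2(X)\<close>: its elements are the square-summable
  functions on \<open>X\<close>, extended by \<open>0\<close> outside \<open>X\<close>. Operators from \<open>\<ell>\<^sup>2(X)\<close> to \<open>\<ell>\<^sup>2(Y)\<close> are HOL functions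
  of which only the values on \<open>ell2 X\<close> are relevant. The space \<open>\<ell>\<^sup>2(H) \<otimes> \<complex>\<^sup>2\<close> is \<open>ell2 (H \<times> (UNIV :: 2 set))\<close>,
  where \<open>|x\<rangle>|j\<rangle>\<close> is \<open>ket (x, j)\<close>; the index type \<open>2\<close> has the two elements \<open>1\<close> and \<open>2\<close>.\<close>

definition ell2 :: "'x set \<Rightarrow> ('x \<Rightarrow> complex) set" where
  "ell2 X = {\<psi>. (\<forall>x. x \<notin> X \<longrightarrow> \<psi> x = 0) \<and> (\<lambda>x. (cmod (\<psi> x))\<^sup>2) summable_on X}"

definition ket :: "'x \<Rightarrow> 'x \<Rightarrow> complex" where
  "ket x = (\<lambda>y. if y = x then 1 else 0)"

definition ell2_inner :: "'x set \<Rightarrow> ('x \<Rightarrow> complex) \<Rightarrow> ('x \<Rightarrow> complex) \<Rightarrow> complex" where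
  "ell2_inner X \<phi> \<psi> = (\<Sum>\<^sub>\<infinity>x\<in>X. cnj (\<phi> x) * \<psi> x)"

definition unitary_operator ::
    "'x set \<Rightarrow> 'y set \<Rightarrow> (('x \<Rightarrow> complex) \<Rightarrow> ('y \<Rightarrow> complex)) \<Rightarrow> bool" where
  "unitary_operator X Y F \<longleftrightarrow>
     (\<forall>\<phi>\<in>ell2 X. \<forall>\<psi>\<in>ell2 X. \<forall>a b.
        F (\<lambda>x. a * \<phi> x + b * \<psi> x) = (\<lambda>y. a * F \<phi> y + b * F \<psi> y)) \<and>
     F ` ell2 X = ell2 Y \<and>
     (\<forall>\<phi>\<in>ell2 X. \<forall>\<psi>\<in>ell2 X. ell2_inner Y (F \<phi>) (F \<psi>) = ell2_inner X \<phi> \<psi>)"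

text \<open>The adjoint of a bounded operator \<open>F\<close> from \<open>\<ell>\<^sup>2(X)\<close> to \<open>\<ell>\<^sup>2(Y)\<close>, given by
  \<open>\<langle>x|F\<^sup>\<dagger>\<psi>\<rangle> = \<langle>F x|\<psi>\<rangle>\<close>.\<close>

definition ell2_adjoint ::
    "'x set \<Rightarrow> 'y set \<Rightarrow> (('x \<Rightarrow> complex) \<Rightarrow> ('y \<Rightarrow> complex)) \<Rightarrow> ('y \<Rightarrow> complex) \<Rightarrow> ('x \<Rightarrow> complex)" where
  "ell2_adjoint X Y F \<psi> = (\<lambda>x. if x \<in> X then ell2_inner Y (F (ket x)) \<psi> else 0)"

text \<open>The operator \<open>F \<otimes> M\<close> on \<open>\<ell>\<^sup>2(H) \<otimes> \<complex>\<^sup>2\<close>, for an operator \<open>F\<close> on \<open>\<ell>\<^sup>2(H)\<close> and a matrix \<open>M\<close>.\<close>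

definition tensor_op ::
    "(('x \<Rightarrow> complex) \<Rightarrow> ('x \<Rightarrow> complex)) \<Rightarrow> complex^2^2 \<Rightarrow> ('x \<times> 2 \<Rightarrow> complex) \<Rightarrow> ('x \<times> 2 \<Rightarrow> complex)" where
  "tensor_op F M \<psi> = (\<lambda>(x, i). \<Sum>j\<in>UNIV. M $ i $ j * F (\<lambda>y. \<psi> (y, j)) x)"

text \<open>\<open>T\<^sub>g|x\<rangle> = |xg\<^sup>-\<^sup>1\<rangle>\<close> means that the amplitude of \<open>T\<^sub>g \<psi>\<close> at \<open>x\<close> is \<open>\<psi>(xg)\<close>.\<close>

definition right_regular :: "('g, 'b) monoid_scheme \<Rightarrow> 'g \<Rightarrow> ('g \<Rightarrow> complex) \<Rightarrow> ('g \<Rightarrow> complex)" where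
  "right_regular G g \<psi> = (\<lambda>x. if x \<in> carrier G then \<psi> (x \<otimes>\<^bsub>G\<^esub> g) else 0)"

lemma right_regular_ket:
  assumes "group G" "g \<in> carrier G" "x \<in> carrier G"
  shows "right_regular G g (ket x) = ket (x \<otimes>\<^bsub>G\<^esub> inv\<^bsub>G\<^esub> g)"
proof -
  interpret group G by fact
  show ?thesis
    using assms(2,3) by (auto simp: right_regular_def ket_def fun_eq_iff m_assoc)
qed

definition scalar_quantum_walk ::
    "('g, 'b) monoid_scheme \<Rightarrow> (('g \<Rightarrow> complex) \<Rightarrow> ('g \<Rightarrow> complex)) \<Rightarrow> bool" where
  "scalar_quantum_walk G A' \<longleftrightarrow>
     unitary_operator (carrier G) (carrier G) A' \<and>
     (\<exists>S z. finite S \<and> S \<subseteq> carrier G \<and> generate G S = carrier G \<and> (\<forall>h\<in>S. z h \<noteq> 0) \<and>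
        (\<forall>\<psi>\<in>ell2 (carrier G). A' \<psi> = (\<lambda>x. \<Sum>h\<in>S. z h * right_regular G h \<psi> x)))"

text \<open>The unitary \<open>U\<^sub>H\<close> with \<open>U\<^sub>H|xc\<^sub>j\<rangle> = |x\<rangle>|j\<rangle>\<close> for \<open>x \<in> H\<close>; equivalently the amplitude of \<open>U\<^sub>H \<psi>\<close>
  at \<open>(x, j)\<close> is \<open>\<psi>(xc\<^sub>j)\<close>.\<close>

definition coset_unitary ::
    "('g, 'b) monoid_scheme \<Rightarrow> 'g set \<Rightarrow> (2 \<Rightarrow> 'g) \<Rightarrow> ('g \<Rightarrow> complex) \<Rightarrow> ('g \<times> 2 \<Rightarrow> complex)" where
  "coset_unitary G H c \<psi> = (\<lambda>(x, j). if x \<in> H then \<psi> (x \<otimes>\<^bsub>G\<^esub> c j) else 0)"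

lemma coset_unitary_ket:
  assumes "group G" "subgroup H G" "\<And>j. c j \<in> carrier G"
    and "(H #>\<^bsub>G\<^esub> c 1) \<inter> (H #>\<^bsub>G\<^esub> c 2) = {}" "x \<in> H"
  shows "coset_unitary G H c (ket (x \<otimes>\<^bsub>G\<^esub> c j)) = ket (x, j)"
proof -
  interpret group G by fact
  interpret H: subgroup H G by fact
  have eq: "y = x \<and> i = j" if "y \<in> H" "y \<otimes>\<^bsub>G\<^esub> c i = x \<otimes>\<^bsub>G\<^esub> c j" for y i
  proof -
    have "y \<otimes>\<^bsub>G\<^esub> c i \<in> (H #>\<^bsub>G\<^esub> c i) \<inter> (H #>\<^bsub>G\<^esub> c j)"
      using that assms(5) unfolding r_coset_def by blast
    moreover have "i = 1 \<or> i = 2" "j = 1 \<or> j = 2"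
      using exhaust_2 by blast+
    ultimately have "i = j"
      using assms(4) by (metis Int_commute empty_iff)
    then show ?thesis
      using that assms(3,5) by auto
  qed
  show ?thesis
    using assms(5) by (auto simp: coset_unitary_def ket_def fun_eq_iff dest: eq)
qed

lemma coset_unitary_adjoint:
  assumes "group G" "subgroup H G" "\<And>j. c j \<in> carrier G"
    and "(H #>\<^bsub>G\<^esub> c 1) \<inter> (H #>\<^bsub>G\<^esub> c 2) = {}" "x \<in> H"
  shows "ell2_adjoint (carrier G) (H \<times> UNIV) (coset_unitary G H c) \<psi> (x \<otimes>\<^bsub>G\<^esub> c j) = \<psi> (x, j)"
proof -
  interpret group G by fact
  interpret H: subgroup H G by fact
  have "(\<Sum>\<^sub>\<infinity>p\<in>H \<times> UNIV. cnj (ket (x, j) p) * \<psi> p) = (\<Sum>\<^sub>\<infinity>p\<in>{(x, j)}. \<psi> p)"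
    by (rule infsum_cong_neutral) (use assms(5) in \<open>auto simp: ket_def\<close>)
  moreover have "x \<otimes>\<^bsub>G\<^esub> c j \<in> carrier G"
    using assms(3,5) by simp
  ultimately show ?thesis
    by (simp add: ell2_adjoint_def ell2_inner_def coset_unitary_ket[OF assms])
qed

definition coarse_graining ::
    "('g, 'b) monoid_scheme \<Rightarrow> 'g set \<Rightarrow> (2 \<Rightarrow> 'g) \<Rightarrow> (('g \<Rightarrow> complex) \<Rightarrow> ('g \<Rightarrow> complex)) \<Rightarrow>
     ('g \<times> 2 \<Rightarrow> complex) \<Rightarrow> ('g \<times> 2 \<Rightarrow> complex)" where
  "coarse_graining G H c A' =
     coset_unitary G H c \<circ> A' \<circ> ell2_adjoint (carrier G) (H \<times> UNIV) (coset_unitary G H c)"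

definition index_two_representatives :: "('g, 'b) monoid_scheme \<Rightarrow> 'g set \<Rightarrow> (2 \<Rightarrow> 'g) \<Rightarrow> bool" where
  "index_two_representatives G H c \<longleftrightarrow>
     subgroup H G \<and> card (rcosets\<^bsub>G\<^esub> H) = 2 \<and> (\<forall>j. c j \<in> carrier G) \<and>
     carrier G = (H #>\<^bsub>G\<^esub> c 1) \<union> (H #>\<^bsub>G\<^esub> c 2)"

text \<open>\<open>R = \<Sum>\<^sub>n T\<^bsub>a^n\<^esub> \<otimes> A\<^sub>n\<close> as an operator on \<open>\<ell>\<^sup>2(H) \<otimes> \<complex>\<^sup>2\<close>, with \<open>T\<close> the right regular
  representation of \<open>H = \<langle>a\<rangle>\<close>, and \<open>\<sigma>(k) = \<Sum>\<^sub>n e\<^bsup>-ikn\<^esup> A\<^sub>n\<close>.\<close>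

definition has_symbol ::
    "('g, 'b) monoid_scheme \<Rightarrow> 'g set \<Rightarrow> 'g \<Rightarrow> (('g \<times> 2 \<Rightarrow> complex) \<Rightarrow> ('g \<times> 2 \<Rightarrow> complex)) \<Rightarrow>
     (real \<Rightarrow> complex^2^2) \<Rightarrow> bool" where
  "has_symbol G H a R \<sigma> \<longleftrightarrow>
     (\<exists>(N :: int set) (A :: int \<Rightarrow> complex^2^2). finite N \<and>
        (\<forall>\<psi>\<in>ell2 (H \<times> UNIV). R \<psi> =
           (\<lambda>p. \<Sum>n\<in>N. tensor_op (right_regular (G\<lparr>carrier := H\<rparr>) (a [^]\<^bsub>G\<^esub> n)) (A n) \<psi> p)) \<and>
        (\<forall>k\<in>{-pi..pi}. \<sigma> k = (\<Sum>n\<in>N. mat (exp (- \<i> * of_real k * of_int n)) ** A n)))"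

definition conjugate_transpose :: "complex^2^2 \<Rightarrow> complex^2^2" where
  "conjugate_transpose U = (\<chi> i j. cnj (U $ j $ i))"

definition unitary_matrix :: "complex^2^2 \<Rightarrow> bool" where
  "unitary_matrix U \<longleftrightarrow> conjugate_transpose U ** U = mat 1 \<and> U ** conjugate_transpose U = mat 1"

definition hadamard_symbol :: "real \<Rightarrow> complex^2^2" where
  "hadamard_symbol k =
     (vector [vector [exp (- \<i> * of_real k), 0], vector [0, exp (\<i> * of_real k)]] :: complex^2^2) **
     (mat (1 / of_real (sqrt 2)) ** (vector [vector [1, 1], vector [1, -1]] :: complex^2^2))"

end

theory Submission
  imports Defs
begin

text \<open>Let \<open>z\<close> be the amplitude of the walk, extended by \<open>0\<close> to all of \<open>G\<close>. The matrix entries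
  of the coarse-graining are \<open>(A\<^sub>n)\<^sub>i\<^sub>j = z(c\<^sub>i\<^sup>-\<^sup>1 a\<^sup>n c\<^sub>j)\<close>. Since \<open>H\<close> has index 2, conjugation by
  \<open>c\<^sub>j\<close> maps \<open>a\<close> to \<open>a\<^sup>\<plusminus>\<^sup>1\<close>. If the signs for \<open>c\<^sub>1\<close> and \<open>c\<^sub>2\<close> differ, then \<open>A\<^sub>1\<close> and \<open>A\<^sub>-\<^sub>1\<close> have
  the same trace, whereas the Hadamard walk requires \<open>1/\<surd>2\<close> and \<open>-1/\<surd>2\<close>. Otherwise \<open>G\<close> is abelian,
  the diagonal entries of \<open>A\<^sub>n\<close> agree, and so do the off-diagonal ones up to a shift of \<open>n\<close>. For
  \<open>n = \<plusminus>1\<close> the matrix \<open>A\<^sub>n\<close> is singular with nonzero trace, so its off-diagonal entries do not vanish;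
  as all other \<open>A\<^sub>n\<close> are zero, the shift is trivial. The resulting matrices cannot satisfy
  \<open>tr(A\<^sub>1 A\<^sub>-\<^sub>1) = 1/2\<close>.\<close>

section \<open>Coefficients of the symbol\<close>

text \<open>Up to a nonvanishing factor the sum is a polynomial in \<open>exp (- \<i> * k)\<close>,
  and a polynomial with infinitely many roots is zero.\<close>

lemma trigonometric_polynomial_zero_imp_coeff_zero:
  fixes c :: "int \<Rightarrow> complex"
  assumes "finite N"
    and zero: "\<And>k. k \<in> {-pi..pi} \<Longrightarrow> (\<Sum>n\<in>N. exp (- \<i> * of_real k * of_int n) * c n) = 0"
    and "m \<in> N"
  shows "c m = 0"
proof -
  \<comment> \<open>Shifting by \<open>M\<close> makes all exponents nonnegative, so
    \<open>nat (n + M)\<close> loses no information.\<close>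
  obtain M :: int where M: "\<And>n. n \<in> N \<Longrightarrow> - M \<le> n"
    using \<open>finite N\<close> by (metis Min_le minus_minus)
  define p where "p = (\<Sum>n\<in>N. monom (c n) (nat (n + M)))"
  have root: "poly p (exp (- \<i> * of_real k)) = 0" if "k \<in> {-pi..pi}" for k
  proof -
    have "poly p (exp (- \<i> * of_real k)) = (\<Sum>n\<in>N. c n * exp (- \<i> * of_real k) ^ nat (n + M))"
      by (simp add: p_def poly_sum poly_monom)
    also have "\<dots> = (\<Sum>n\<in>N. exp (- \<i> * of_real k * of_int M) * (exp (- \<i> * of_real k * of_int n) * c n))"
    proof (rule sum.cong)
      fix n assume "n \<in> N"
      then have "of_nat (nat (n + M)) = (of_int (n + M) :: complex)"
        using M[of n] by (simp add: of_nat_nat)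
      then have "exp (- \<i> * of_real k) ^ nat (n + M) = exp (of_int (n + M) * (- \<i> * of_real k))"
        by (metis exp_of_nat_mult)
      then show "c n * exp (- \<i> * of_real k) ^ nat (n + M) =
          exp (- \<i> * of_real k * of_int M) * (exp (- \<i> * of_real k * of_int n) * c n)"
        by (simp add: algebra_simps flip: exp_add)
    qed simp
    also have "\<dots> = 0"
      using zero[OF that] by (simp flip: sum_distrib_left)
    finally show ?thesis .
  qed
  \<comment> \<open>The endpoints \<open>-pi\<close> and \<open>pi\<close> give the same root; on
    \<open>{0..pi}\<close> the real part \<open>cos\<close> already separates points.\<close>
  have "inj_on (\<lambda>k::real. exp (- \<i> * of_real k)) {0..pi}"
  proof (rule inj_onI)
    fix x y :: real
    assume xy: "x \<in> {0..pi}" "y \<in> {0..pi}" and "exp (- \<i> * of_real x) = exp (- \<i> * of_real y)"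
    then have "Re (exp (- \<i> * of_real x)) = Re (exp (- \<i> * of_real y))"
      by simp
    then have "cos x = cos y"
      by (simp add: Re_exp)
    then show "x = y"
      using xy cos_inj_pi by auto
  qed
  moreover have "infinite {0..pi}"
    by (simp add: infinite_Icc)
  ultimately have "infinite ((\<lambda>k::real. exp (- \<i> * of_real k)) ` {0..pi})"
    by (simp add: finite_image_iff)
  moreover have "(\<lambda>k::real. exp (- \<i> * of_real k)) ` {0..pi} \<subseteq> {x. poly p x = 0}"
    using root by auto
  ultimately have "p = 0"
    using finite_subset poly_roots_finite by blast
  then have "0 = coeff p (nat (m + M))"
    by simp
  also have "\<dots> = (\<Sum>n\<in>N. if n = m then c n else 0)"
    unfolding p_def coeff_sum coeff_monom
  proof (rule sum.cong)
    fix n assume "n \<in> N"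
    then have "nat (n + M) = nat (m + M) \<longleftrightarrow> n = m"
      using M[of n] M[OF \<open>m \<in> N\<close>] by auto
    then show "(if nat (n + M) = nat (m + M) then c n else 0) = (if n = m then c n else 0)"
      by simp
  qed simp
  also have "\<dots> = c m"
    using assms by simp
  finally show ?thesis
    by simp
qed

text \<open>The Fourier coefficients of \<open>hadamard_symbol\<close>: with the convention
  \<open>exp (- \<i> * k * n)\<close>, the first row of the Hadamard matrix belongs to
  \<open>n = 1\<close> and the second to \<open>n = -1\<close>.\<close>

definition hadamard_coeff :: "int \<Rightarrow> complex^2^2" where
  "hadamard_coeff n =
     (if n = 1 then vector [vector [1 / sqrt 2, 1 / sqrt 2], vector [0, 0]]
      else if n = -1 then vector [vector [0, 0], vector [1 / sqrt 2, - (1 / sqrt 2)]]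
      else 0)"

lemma hadamard_symbol_nth:
  fixes U V :: "complex^2^2"
  shows "(U ** hadamard_symbol k ** V) $ i $ j =
     exp (- \<i> * of_real k) * (U ** hadamard_coeff 1 ** V) $ i $ j +
     exp (\<i> * of_real k) * (U ** hadamard_coeff (-1) ** V) $ i $ j"
  by (simp add: hadamard_symbol_def hadamard_coeff_def matrix_matrix_mult_def sum_2 mat_def)
     (simp add: algebra_simps add_divide_distrib)

text \<open>Entrywise uniqueness of Fourier coefficients. The set \<open>N\<close> is arbitrary,
  hence the extension of \<open>A\<close> by zero.\<close>

lemma hadamard_symbol_coefficients:
  fixes U V :: "complex^2^2"
  assumes "finite N"
    and sym: "\<And>k. k \<in> {-pi..pi} \<Longrightarrow> U ** hadamard_symbol k ** V =
      (\<Sum>n\<in>N. mat (exp (- \<i> * of_real k * of_int n)) ** A n)"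
  shows "(if n \<in> N then A n else 0) = U ** hadamard_coeff n ** V"
proof -
  have "(if n \<in> N then A n else 0) $ i $ j = (U ** hadamard_coeff n ** V) $ i $ j" for i j
  proof -
    define E where "E n = (U ** hadamard_coeff n ** V) $ i $ j" for n
    have E0: "E n = 0" if "n \<noteq> 1" "n \<noteq> -1" for n
      using that by (simp add: E_def hadamard_coeff_def)
    define c where "c n = (if n \<in> N then A n else 0) $ i $ j - E n" for n
    \<comment> \<open>Large enough to carry both expansions as well as the index \<open>n\<close> in
      question.\<close>
    define N' where "N' = insert n (insert 1 (insert (-1) N))"
    have "finite N'"
      using assms(1) by (simp add: N'_def)
    have "(\<Sum>n\<in>N'. exp (- \<i> * of_real k * of_int n) * c n) = 0" if k: "k \<in> {-pi..pi}" for k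
    proof -
      have "(\<Sum>n\<in>N'. exp (- \<i> * of_real k * of_int n) * (if n \<in> N then A n else 0) $ i $ j) =
          (\<Sum>n\<in>N. exp (- \<i> * of_real k * of_int n) * A n $ i $ j)"
        by (rule sum.mono_neutral_cong_right) (use \<open>finite N'\<close> in \<open>auto simp: N'_def\<close>)
      also have "\<dots> = (\<Sum>n\<in>N. mat (exp (- \<i> * of_real k * of_int n)) ** A n) $ i $ j"
        by (simp add: matrix_matrix_mult_def mat_def if_distrib[where f="\<lambda>x. x * _"] cong: if_cong)
      also have "\<dots> = (U ** hadamard_symbol k ** V) $ i $ j"
        using sym[OF k] by simp
      also have "\<dots> = (\<Sum>n\<in>{1, -1}. exp (- \<i> * of_real k * of_int n) * E n)"
        by (simp add: hadamard_symbol_nth E_def)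
      also have "\<dots> = (\<Sum>n\<in>N'. exp (- \<i> * of_real k * of_int n) * E n)"
        by (rule sum.mono_neutral_left) (use \<open>finite N'\<close> E0 in \<open>auto simp: N'_def\<close>)
      finally show ?thesis
        by (simp add: c_def right_diff_distrib sum_subtractf)
    qed
    then have "c n = 0"
      by (rule trigonometric_polynomial_zero_imp_coeff_zero[OF \<open>finite N'\<close>]) (simp_all add: N'_def)
    then show ?thesis
      by (simp add: c_def E_def)
  qed
  then show ?thesis
    by (simp add: vec_eq_iff)
qed

text \<open>Here \<open>V\<close> is the inverse of \<open>U\<close>, so traces and determinants can
  be read off from \<open>hadamard_coeff\<close>, whose values all have a zero row.\<close>

lemma hadamard_coeff_similar:
  fixes U V :: "complex^2^2"
  assumes "V ** U = mat 1" and B: "\<And>n. B n = U ** hadamard_coeff n ** V"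
  shows "trace (B 1) = 1 / sqrt 2" "trace (B (-1)) = - (1 / sqrt 2)"
    "trace (B 1 ** B (-1)) = 1 / 2" "det (B n) = 0" "n \<noteq> 1 \<Longrightarrow> n \<noteq> -1 \<Longrightarrow> B n = 0"
proof -
  have tr: "trace (U ** D ** V) = trace D" for D
    by (metis assms(1) matrix_mul_assoc matrix_mul_lid trace_mul_sym)
  show "trace (B 1) = 1 / sqrt 2" "trace (B (-1)) = - (1 / sqrt 2)"
    by (simp_all add: B tr) (simp_all add: trace_def hadamard_coeff_def sum_2)
  have "B 1 ** B (-1) = U ** (hadamard_coeff 1 ** hadamard_coeff (-1)) ** V"
    unfolding B by (metis assms(1) matrix_mul_assoc matrix_mul_lid)
  then show "trace (B 1 ** B (-1)) = 1 / 2"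
    by (simp only: tr) (simp add: trace_def hadamard_coeff_def sum_2 matrix_matrix_mult_def
        flip: of_real_mult)
  show "det (B n) = 0"
    unfolding B det_mul by (simp add: det_2 hadamard_coeff_def)
  show "B n = 0" if "n \<noteq> 1" "n \<noteq> -1"
    using that by (simp add: B hadamard_coeff_def)
qed

text \<open>For diagonal entries \<open>x\<close>, \<open>x'\<close> and off-diagonal entries
  \<open>y\<close>, \<open>y'\<close>, the traces give \<open>x = - x' = 1 / (2 * sqrt 2)\<close>
  and the determinants \<open>y * y = y' * y' = 1 / 8\<close>, whereas the trace of the product
  forces \<open>y * y' = 3 / 8\<close>.\<close>

lemma equal_diagonals_imp_False:
  fixes P Q :: "complex^2^2"
  assumes "P $ 1 $ 1 = P $ 2 $ 2" "Q $ 1 $ 1 = Q $ 2 $ 2" "P $ 1 $ 2 = P $ 2 $ 1" "Q $ 1 $ 2 = Q $ 2 $ 1"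
    and "trace P = 1 / sqrt 2" "trace Q = - (1 / sqrt 2)" "det P = 0" "det Q = 0" "trace (P ** Q) = 1 / 2"
  shows False
proof -
  define x y x' y' where "x = P $ 1 $ 1" "y = P $ 1 $ 2" "x' = Q $ 1 $ 1" "y' = Q $ 1 $ 2"
  note d = this
  have "2 * x = 1 / sqrt 2" "2 * x' = - (1 / sqrt 2)"
    using assms(1-6) by (simp_all add: d trace_def sum_2)
  then have x: "x = 1 / (2 * sqrt 2)" "x' = - (1 / (2 * sqrt 2))"
    by (simp_all add: field_simps)
  have "complex_of_real (sqrt 2) * complex_of_real (sqrt 2) = 2"
    by (simp flip: of_real_mult)
  then have xx: "x * x = 1 / 8" "x * x' = - (1 / 8)" "x' * x' = 1 / 8"
    unfolding x by simp_all
  have yy: "y * y = 1 / 8" "y' * y' = 1 / 8"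
    using assms(1-4,7,8) xx by (simp_all add: d det_2)
  have "2 * (x * x') + 2 * (y * y') = 1 / 2"
    using assms(1-4,9) by (simp add: d trace_def sum_2 matrix_matrix_mult_def algebra_simps)
  then have "y * y' = (1 / 2 - 2 * (x * x')) / 2"
    by (simp add: field_simps)
  then have "y * y' = 3 / 8"
    unfolding xx by simp
  then have "(y * y) * (y' * y') = (3 / 8) * (3 / 8)"
    by (metis mult.assoc mult.left_commute)
  then show False
    using yy by simp
qed

section \<open>Subgroups of index two\<close>

lemma (in group) r_inv_assoc:
  assumes "x \<in> carrier G" "y \<in> carrier G"
  shows "x \<otimes> (inv x \<otimes> y) = y"
  using assms by (simp flip: m_assoc)

text \<open>The representatives are only known to cover \<open>G\<close>; since there are exactly
  two cosets, theirs must be distinct, and \<open>H\<close> is one of them.\<close>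

lemma (in group) index_two_disjoint:
  assumes "index_two_representatives G H c"
  shows "(H #> c 1) \<inter> (H #> c 2) = {}" "H #> c 1 = H \<or> H #> c 2 = H"
proof -
  have H: "subgroup H G" and card: "card (rcosets H) = 2" and c: "\<And>j. c j \<in> carrier G"
    and un: "carrier G = (H #> c 1) \<union> (H #> c 2)"
    using assms by (auto simp: index_two_representatives_def)
  have "rcosets H \<subseteq> {H #> c 1, H #> c 2}"
  proof
    fix K assume "K \<in> rcosets H"
    then obtain g where g: "g \<in> carrier G" "K = H #> g"
      by (auto simp: RCOSETS_def)
    then obtain j where "g \<in> H #> c j" "j = 1 \<or> j = 2"
      using un by blast
    then show "K \<in> {H #> c 1, H #> c 2}"
      using repr_independence[OF _ c H, of g j] g by auto
  qed
  moreover have "{H #> c 1, H #> c 2} \<subseteq> rcosets H"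
    using c H by (auto simp: rcosetsI subgroup.subset)
  ultimately have eq: "rcosets H = {H #> c 1, H #> c 2}"
    by blast
  then have "H #> c 1 \<noteq> H #> c 2"
    using card by auto
  then show "(H #> c 1) \<inter> (H #> c 2) = {}"
    using rcos_disjoint[OF H] by (simp add: eq pairwise_def disjnt_def)
  show "H #> c 1 = H \<or> H #> c 2 = H"
    using subgroup.subgroup_in_rcosets[OF H is_group] eq by auto
qed

text \<open>Both \<open>g\<close> and \<open>inv g'\<close> lie in the only coset other than
  \<open>H\<close>.\<close>

lemma (in group) index_two_mult_in_subgroup:
  assumes "index_two_representatives G H c"
    and "g \<in> carrier G" "g \<notin> H" "g' \<in> carrier G" "g' \<notin> H"
  shows "g \<otimes> g' \<in> H"
proof -
  have H: "subgroup H G" and un: "carrier G = (H #> c 1) \<union> (H #> c 2)" and c: "\<And>j. c j \<in> carrier G"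
    using assms(1) by (auto simp: index_two_representatives_def)
  have inv: "inv g' \<in> carrier G" "inv g' \<notin> H"
    using assms(4,5) H by (auto dest: subgroup.m_inv_closed)
  obtain j where j: "g \<in> H #> c j" "inv g' \<in> H #> c j"
    using index_two_disjoint(2)[OF assms(1)] un assms(2,3) inv by blast
  then have "g \<in> H #> inv g'"
    using repr_independence[OF j(2) _ H] c by metis
  then show ?thesis
    using subgroup.rcos_module_imp[OF H is_group inv(1)] assms(4) by simp
qed

text \<open>Normality of \<open>H\<close>: for \<open>g\<close> outside \<open>H\<close>, the
  factors \<open>g \<otimes> h\<close> and \<open>inv g\<close> both lie outside
  \<open>H\<close>.\<close>

lemma (in group) index_two_conj_in_subgroup:
  assumes "index_two_representatives G H c" "g \<in> carrier G" "h \<in> H"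
  shows "g \<otimes> h \<otimes> inv g \<in> H"
proof -
  have H: "subgroup H G"
    using assms(1) by (auto simp: index_two_representatives_def)
  show ?thesis
  proof (cases "g \<in> H")
    case True
    then show ?thesis
      using H assms(3) by (simp add: subgroup.m_closed subgroup.m_inv_closed)
  next
    case False
    have h: "h \<in> carrier G"
      using H assms(3) by (rule subgroup.mem_carrier)
    have "g \<otimes> h \<notin> H"
    proof
      assume "g \<otimes> h \<in> H"
      then have "g \<otimes> h \<otimes> inv h \<in> H"
        using H assms(3) by (simp add: subgroup.m_closed subgroup.m_inv_closed)
      then show False
        using False h assms(2) by (simp add: m_assoc)
    qed
    moreover have "inv g \<notin> H"
      using False H assms(2) by (metis inv_inv subgroup.m_inv_closed)
    ultimately show ?thesis
      using index_two_mult_in_subgroup[OF assms(1)] h assms(2) by simp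
  qed
qed

lemma (in group) conj_int_pow:
  assumes "g \<in> carrier G" "x \<in> carrier G"
  shows "inv g \<otimes> x [^] (n :: int) \<otimes> g = (inv g \<otimes> x \<otimes> g) [^] n"
proof -
  have "(\<lambda>y. inv g \<otimes> y \<otimes> g) \<in> hom G G"
    using assms(1) by (auto simp: hom_def m_assoc r_inv_assoc)
  then show ?thesis
    using hom_int_pow[of "\<lambda>y. inv g \<otimes> y \<otimes> g" G G x n] assms is_group by auto
qed

text \<open>An isomorphism \<open>\<phi>\<close> to the integers sends \<open>a [^] k\<close> to
  \<open>k * \<phi> a\<close>, and \<open>\<phi> a = 0\<close> would contradict surjectivity because
  \<open>a\<close> generates \<open>H\<close>.\<close>

lemma (in group) infinite_cyclic_generator_int_pow_inj:
  assumes H: "subgroup H G" and iso: "G\<lparr>carrier := H\<rparr> \<cong> integer_group" and "a \<in> H" "generate G {a} = H"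
    and "a [^] (m :: int) = a [^] (n :: int)"
  shows "m = n"
proof -
  obtain \<phi> where \<phi>: "\<phi> \<in> hom (G\<lparr>carrier := H\<rparr>) integer_group" "bij_betw \<phi> H UNIV"
    using iso by (auto simp: is_iso_def iso_def)
  have pow: "\<phi> (a [^] k) = k * \<phi> a" for k :: int
    using hom_int_pow[OF \<phi>(1), of a k] \<open>a \<in> H\<close> subgroup_imp_group[OF H] int_pow_consistent[OF H, of a k]
    by simp
  have "\<phi> a \<noteq> 0"
  proof
    assume "\<phi> a = 0"
    then have "\<phi> h = 0" if "h \<in> H" for h
      using that pow generate_pow[of a] subgroup.mem_carrier[OF H] assms(3,4) by auto
    moreover obtain h where "h \<in> H" "\<phi> h = 1"
      using \<phi>(2) by (metis UNIV_I bij_betw_apply bij_betw_inv_into bij_betw_inv_into_right)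
    ultimately show False
      by simp
  qed
  moreover have "m * \<phi> a = n * \<phi> a"
    using pow assms(5) by metis
  ultimately show ?thesis
    by simp
qed

text \<open>Conjugation by \<open>g\<close> and by \<open>inv g\<close> raise \<open>a\<close> to
  integer powers \<open>p\<close> and \<open>q\<close>; being mutually inverse, they satisfy
  \<open>p * q = 1\<close>.\<close>

lemma (in group) conj_infinite_cyclic_generator:
  assumes "index_two_representatives G H c" "a \<in> H" "generate G {a} = H"
    and inj: "\<And>m n :: int. a [^] m = a [^] n \<Longrightarrow> m = n" and "g \<in> carrier G"
  obtains e :: int where "e = 1 \<or> e = -1" "\<And>n :: int. inv g \<otimes> a [^] n \<otimes> g = a [^] (e * n)"
proof -
  have H: "subgroup H G"
    using assms(1) by (auto simp: index_two_representatives_def)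
  then have a: "a \<in> carrier G"
    using assms(2) by (rule subgroup.mem_carrier)
  have powers: "\<exists>n :: int. h = a [^] n" if "h \<in> H" for h
    using that generate_pow[OF a] assms(3) by auto
  obtain p :: int where p: "inv g \<otimes> a \<otimes> g = a [^] p"
    using powers index_two_conj_in_subgroup[OF assms(1), of "inv g" a] assms(2,5)
    by (metis inv_closed inv_inv)
  obtain q :: int where q: "g \<otimes> a \<otimes> inv g = a [^] q"
    using powers index_two_conj_in_subgroup[OF assms(1), of g a] assms(2,5) by metis
  have conj: "inv g \<otimes> a [^] n \<otimes> g = a [^] (p * n)" for n :: int
    by (simp add: conj_int_pow assms(5) a p int_pow_pow)
  have "a [^] (p * q) = inv g \<otimes> (g \<otimes> a \<otimes> inv g) \<otimes> g"
    by (simp add: q conj)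
  also have "\<dots> = a"
    using assms(5) a by (simp add: m_assoc inv_solve_left')
  finally have "p * q = 1"
    using inj[of "p * q" 1] a by simp
  then have "p = 1 \<or> p = -1"
    by (metis zmult_eq_1_iff)
  then show ?thesis
    using that conj by blast
qed

section \<open>Matrix entries of the coarse-graining\<close>

lemma ket_in_ell2:
  assumes "x \<in> X"
  shows "ket x \<in> ell2 X"
proof -
  have "(\<lambda>y. (cmod (ket x y))\<^sup>2) summable_on X"
    by (rule finite_nonzero_values_imp_summable_on)
       (auto simp: ket_def intro: finite_subset[of _ "{x}"])
  then show ?thesis
    using assms by (auto simp: ell2_def ket_def)
qed

lemma (in group) coset_unitary_adjoint_ket:
  assumes "index_two_representatives G H c" "x \<in> H"
  shows "ell2_adjoint (carrier G) (H \<times> UNIV) (coset_unitary G H c) (ket (x, j)) = ket (x \<otimes> c j)"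
proof
  have H: "subgroup H G" and un: "carrier G = (H #> c 1) \<union> (H #> c 2)" and c: "\<And>j. c j \<in> carrier G"
    using assms(1) by (auto simp: index_two_representatives_def)
  note disj = index_two_disjoint(1)[OF assms(1)]
  fix g
  show "ell2_adjoint (carrier G) (H \<times> UNIV) (coset_unitary G H c) (ket (x, j)) g = ket (x \<otimes> c j) g"
  proof (cases "g \<in> carrier G")
    case True
    then obtain y i where y: "y \<in> H" "g = y \<otimes> c i"
      using un by (auto simp: r_coset_def)
    have "ket (y \<otimes> c i) (x \<otimes> c j) = (ket (y, i) (x, j) :: complex)"
      using fun_cong[OF coset_unitary_ket[OF is_group H c disj y(1)], of i "(x, j)"] assms(2)
      by (simp add: coset_unitary_def)
    then show ?thesis
      unfolding y(2) coset_unitary_adjoint[OF is_group H c disj y(1)] by (auto simp: ket_def split: if_splits)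
  next
    case False
    moreover have "x \<otimes> c j \<in> carrier G"
      using c assms(2) subgroup.mem_carrier[OF H] by simp
    ultimately show ?thesis
      by (auto simp: ell2_adjoint_def ket_def)
  qed
qed

text \<open>Both descriptions of the coarse-graining are evaluated on the basis vector
  \<open>ket (a [^] m, j)\<close> at the point \<open>(\<one>, i)\<close>. On the walk side only the
  \<open>h\<close> with \<open>c i \<otimes> h = a [^] m \<otimes> c j\<close> contributes.\<close>

lemma (in group) coarse_graining_coefficients:
  fixes N :: "int set"
  assumes "index_two_representatives G H c" "a \<in> H"
    and inj: "\<And>m n :: int. a [^] m = a [^] n \<Longrightarrow> m = n"
    and "finite S" "S \<subseteq> carrier G"
    and walk: "\<And>\<psi>. \<psi> \<in> ell2 (carrier G) \<Longrightarrow> A' \<psi> = (\<lambda>x. \<Sum>h\<in>S. z h * right_regular G h \<psi> x)"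
    and "finite N"
    and R: "\<And>\<psi>. \<psi> \<in> ell2 (H \<times> UNIV) \<Longrightarrow> coarse_graining G H c A' \<psi> =
      (\<lambda>p. \<Sum>n\<in>N. tensor_op (right_regular (G\<lparr>carrier := H\<rparr>) (a [^] n)) (A n) \<psi> p)"
  shows "(if m \<in> N then A m else 0) $ i $ j =
    (if inv c i \<otimes> a [^] m \<otimes> c j \<in> S then z (inv c i \<otimes> a [^] m \<otimes> c j) else 0)"
proof -
  have H: "subgroup H G" and c: "\<And>j. c j \<in> carrier G"
    using assms(1) by (auto simp: index_two_representatives_def)
  have a: "a \<in> carrier G" and aH: "a [^] m \<in> H" for m :: int
    using H assms(2) by (auto simp: subgroup.mem_carrier subgroup_int_pow_closed)
  have one: "\<one> \<in> H"
    using H by (rule subgroup.one_closed)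
  let ?\<psi> = "ket (a [^] m, j)" and ?g = "inv c i \<otimes> a [^] m \<otimes> c j"
  have "coarse_graining G H c A' ?\<psi> (\<one>, i) = A' (ket (a [^] m \<otimes> c j)) (c i)"
    using one c by (simp add: coarse_graining_def coset_unitary_adjoint_ket[OF assms(1) aH] coset_unitary_def)
  also have "\<dots> = (\<Sum>h\<in>S. z h * right_regular G h (ket (a [^] m \<otimes> c j)) (c i))"
    by (subst walk) (use a c in \<open>auto intro!: ket_in_ell2\<close>)
  also have "\<dots> = (\<Sum>h\<in>S. if h = ?g then z h else 0)"
  proof (rule sum.cong)
    fix h assume "h \<in> S"
    then have "h \<in> carrier G"
      using assms(5) by auto
    then have "c i \<otimes> h = a [^] m \<otimes> c j \<longleftrightarrow> h = ?g"
      using a c by (metis inv_solve_left int_pow_closed m_assoc m_closed inv_closed)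
    then show "z h * right_regular G h (ket (a [^] m \<otimes> c j)) (c i) = (if h = ?g then z h else 0)"
      using c by (simp add: right_regular_def ket_def)
  qed simp
  also have "\<dots> = (if ?g \<in> S then z ?g else 0)"
    using \<open>finite S\<close> by simp
  finally have lhs: "coarse_graining G H c A' ?\<psi> (\<one>, i) = (if ?g \<in> S then z ?g else 0)" .
  have "coarse_graining G H c A' ?\<psi> (\<one>, i) =
      (\<Sum>n\<in>N. tensor_op (right_regular (G\<lparr>carrier := H\<rparr>) (a [^] n)) (A n) ?\<psi> (\<one>, i))"
    by (subst R) (use aH in \<open>auto intro!: ket_in_ell2\<close>)
  \<comment> \<open>The amplitude at \<open>\<one>\<close> is nonzero only if
    \<open>a [^] n = a [^] m\<close>; \<open>inj\<close> turns this into
    \<open>n = m\<close>.\<close>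
  also have "\<dots> = (\<Sum>n\<in>N. if n = m then A n $ i $ j else 0)"
  proof (rule sum.cong)
    fix n
    have "tensor_op (right_regular (G\<lparr>carrier := H\<rparr>) (a [^] n)) (A n) ?\<psi> (\<one>, i) =
        (\<Sum>l\<in>UNIV. if l = j then A n $ i $ l * (if n = m then 1 else 0) else 0)"
      unfolding tensor_op_def prod.case
      by (rule sum.cong) (use one a inj in \<open>auto simp: right_regular_def ket_def\<close>)
    then show "tensor_op (right_regular (G\<lparr>carrier := H\<rparr>) (a [^] n)) (A n) ?\<psi> (\<one>, i) =
        (if n = m then A n $ i $ j else 0)"
      by simp
  qed simp
  also have "\<dots> = (if m \<in> N then A m else 0) $ i $ j"
    using \<open>finite N\<close> by simp
  finally show ?thesis
    using lhs by simp
qed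

section \<open>Contradiction from the amplitudes\<close>

text \<open>All matrix entries are values of one function \<open>f\<close> on \<open>G\<close>, so
  entries belonging to the same group element coincide.\<close>

lemma (in group) no_hadamard_amplitudes:
  fixes f :: "'a \<Rightarrow> complex" and B :: "int \<Rightarrow> complex^2^2"
  assumes rep: "index_two_representatives G H c" and aH: "a \<in> H" and gen: "generate G {a} = H"
    and inj: "\<And>m n :: int. a [^] m = a [^] n \<Longrightarrow> m = n"
    and B: "\<And>n i j. B n $ i $ j = f (inv c i \<otimes> a [^] n \<otimes> c j)"
    and tr: "trace (B 1) = 1 / sqrt 2" "trace (B (-1)) = - (1 / sqrt 2)" "trace (B 1 ** B (-1)) = 1 / 2"
    and det: "\<And>n. det (B n) = 0" and zero: "\<And>n. n \<noteq> 1 \<Longrightarrow> n \<noteq> -1 \<Longrightarrow> B n = 0"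
  shows False
proof -
  have H: "subgroup H G" and c: "\<And>j. c j \<in> carrier G"
    using rep by (auto simp: index_two_representatives_def)
  have a: "a \<in> carrier G"
    using H aH by (rule subgroup.mem_carrier)
  have powers: "\<exists>n :: int. h = a [^] n" if "h \<in> H" for h
    using that generate_pow[OF a] gen by auto
  obtain e1 :: int where e1: "e1 = 1 \<or> e1 = -1" "\<And>n :: int. inv c 1 \<otimes> a [^] n \<otimes> c 1 = a [^] (e1 * n)"
    using conj_infinite_cyclic_generator[OF rep aH gen inj c] by blast
  obtain e2 :: int where e2: "e2 = 1 \<or> e2 = -1" "\<And>n :: int. inv c 2 \<otimes> a [^] n \<otimes> c 2 = a [^] (e2 * n)"
    using conj_infinite_cyclic_generator[OF rep aH gen inj c] by blast
  have diag: "B n $ 1 $ 1 = f (a [^] (e1 * n))" "B n $ 2 $ 2 = f (a [^] (e2 * n))" for n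
    by (simp_all add: B e1 e2)
  \<comment> \<open>Opposite signs would make \<open>B 1\<close> and \<open>B (-1)\<close> have the
    same diagonal entries in swapped order.\<close>
  have "e1 = e2"
  proof (rule ccontr)
    assume "e1 \<noteq> e2"
    then have "trace (B 1) = trace (B (-1))"
      using e1(1) e2(1) by (auto simp: trace_def sum_2 diag)
    then show False
      using tr by simp
  qed
  \<comment> \<open>A representative in \<open>H\<close> is a power of \<open>a\<close> and commutes
    with \<open>a\<close>, so its sign is \<open>1\<close>, and then so is the other one.\<close>
  have "c 1 \<in> H \<or> c 2 \<in> H"
    using index_two_disjoint(2)[OF rep] c H by (metis rcos_self)
  moreover have "e = 1" if gH: "g \<in> H" and conj: "inv g \<otimes> a [^] (1::int) \<otimes> g = a [^] (e * 1)" for g and e :: int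
  proof -
    obtain n :: int where n: "g = a [^] n"
      using powers[OF gH] by blast
    have "inv g \<otimes> a [^] (1::int) \<otimes> g = a [^] (- n + 1 + n)"
      using a by (simp only: n int_pow_mult int_pow_neg)
    then show ?thesis
      using conj inj[of "- n + 1 + n" "e * 1"] by simp
  qed
  ultimately have [simp]: "e1 = 1" "e2 = 1"
    using e1(2)[of 1] e2(2)[of 1] \<open>e1 = e2\<close> by metis+
  have conj: "a [^] n = inv c j \<otimes> a [^] n \<otimes> c j" for n :: int and j
    using e1(2)[of n] e2(2)[of n] exhaust_2[of j] by auto
  have comm: "a [^] n \<otimes> c j = c j \<otimes> a [^] n" for n :: int and j
    using conj[of n j] a c by (metis inv_solve_left int_pow_closed m_assoc m_closed inv_closed)
  have cc: "c 1 \<otimes> c 2 = c 2 \<otimes> c 1"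
    using \<open>c 1 \<in> H \<or> c 2 \<in> H\<close> powers comm by metis
  \<comment> \<open>The entries \<open>(2, 1)\<close> and \<open>(1, 2)\<close> of
    \<open>B n\<close> are \<open>f\<close> at \<open>a [^] n \<otimes> u\<close> and at
    \<open>a [^] n \<otimes> inv u\<close>. As \<open>u \<otimes> u = a [^] r\<close>, they differ
    by a shift of \<open>n\<close> by \<open>r\<close>.\<close>
  define u where "u = c 1 \<otimes> inv c 2"
  have u: "u \<in> carrier G"
    using c by (simp add: u_def)
  have "u \<otimes> u \<in> H"
    using H u index_two_mult_in_subgroup[OF rep] by (cases "u \<in> H") (auto simp: subgroup.m_closed)
  then obtain r :: int where r: "u \<otimes> u = a [^] r"
    using powers by blast
  have u': "inv c 2 \<otimes> c 1 = u"
    using c cc unfolding u_def by (metis inv_solve_left inv_solve_right' m_assoc m_closed inv_closed)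
  have inv_u: "inv c 1 \<otimes> c 2 = inv u"
    using c by (simp flip: u' add: inv_mult_group)
  have ac: "inv c j \<otimes> a [^] n = a [^] n \<otimes> inv c j" for n :: int and j
    using conj[of n j] a c by (simp add: inv_solve_right)
  have off: "B n $ 2 $ 1 = B (n + r) $ 1 $ 2" for n
  proof -
    have "inv c 2 \<otimes> a [^] n \<otimes> c 1 = a [^] n \<otimes> u"
      using a c by (simp add: ac m_assoc u')
    also have "u = a [^] r \<otimes> inv u"
      using u by (simp flip: r add: m_assoc)
    also have "a [^] n \<otimes> (a [^] r \<otimes> inv u) = a [^] (n + r) \<otimes> inv u"
      using a u by (simp add: m_assoc int_pow_mult)
    also have "\<dots> = inv c 1 \<otimes> a [^] (n + r) \<otimes> c 2"
      using a c by (simp add: ac m_assoc inv_u)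
    finally show ?thesis
      by (simp add: B)
  qed
  \<comment> \<open>The equal diagonal entries have nonzero sum, and by \<open>det\<close> the
    off-diagonal product is their square.\<close>
  have nz: "B n $ 1 $ 1 \<noteq> 0" "B n $ 1 $ 2 * B n $ 2 $ 1 \<noteq> 0" if "n = 1 \<or> n = -1" for n
  proof -
    show "B n $ 1 $ 1 \<noteq> 0"
      using that tr by (auto simp: trace_def sum_2 diag)
    then show "B n $ 1 $ 2 * B n $ 2 $ 1 \<noteq> 0"
      using det[of n] by (auto simp: det_2 diag)
  qed
  have shift: "n + r = 1 \<or> n + r = -1" if "n = 1 \<or> n = -1" for n
  proof (rule ccontr)
    assume "\<not> ?thesis"
    then have "B (n + r) = 0"
      using zero by blast
    then show False
      using nz(2)[OF that] by (simp add: off)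
  qed
  \<comment> \<open>From \<open>n = 1\<close> the shift is \<open>0\<close> or \<open>-2\<close>,
    from \<open>n = -1\<close> it is \<open>0\<close> or \<open>2\<close>.\<close>
  have "r = 0"
    using shift[of 1] shift[of "-1"] by auto
  show False
    by (rule equal_diagonals_imp_False[OF _ _ _ _ tr(1,2) det det tr(3)])
       (simp_all add: diag off \<open>r = 0\<close>)
qed

theorem mainTheorem4:
  fixes G :: "('g, 'b) monoid_scheme"
  assumes "group G"
  shows "\<not> (\<exists>H a c A' U.
      index_two_representatives G H c \<and>
      G\<lparr>carrier := H\<rparr> \<cong> integer_group \<and> a \<in> H \<and> generate G {a} = H \<and>
      scalar_quantum_walk G A' \<and>
      unitary_matrix U \<and>
      has_symbol G H a (coarse_graining G H c A')
        (\<lambda>k. U ** hadamard_symbol k ** conjugate_transpose U))"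
proof (intro notI, elim exE conjE)
  fix H a c A' U
  assume rep: "index_two_representatives G H c" and iso: "G\<lparr>carrier := H\<rparr> \<cong> integer_group"
    and aH: "a \<in> H" and gen: "generate G {a} = H" and walk: "scalar_quantum_walk G A'"
    and U: "unitary_matrix U"
    and sym: "has_symbol G H a (coarse_graining G H c A')
        (\<lambda>k. U ** hadamard_symbol k ** conjugate_transpose U)"
  interpret group G by fact
  have inj: "m = n" if "a [^]\<^bsub>G\<^esub> m = a [^]\<^bsub>G\<^esub> n" for m n :: int
    using infinite_cyclic_generator_int_pow_inj[OF _ iso aH gen that] rep
    by (simp add: index_two_representatives_def)
  obtain S z where S: "finite S" "S \<subseteq> carrier G"
    and z: "\<And>\<psi>. \<psi> \<in> ell2 (carrier G) \<Longrightarrow> A' \<psi> = (\<lambda>x. \<Sum>h\<in>S. z h * right_regular G h \<psi> x)"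
    using walk unfolding scalar_quantum_walk_def by blast
  obtain N A where N: "finite N"
    and R: "\<And>\<psi>. \<psi> \<in> ell2 (H \<times> UNIV) \<Longrightarrow> coarse_graining G H c A' \<psi> =
      (\<lambda>p. \<Sum>n\<in>N. tensor_op (right_regular (G\<lparr>carrier := H\<rparr>) (a [^]\<^bsub>G\<^esub> n)) (A n) \<psi> p)"
    and A: "\<And>k. k \<in> {-pi..pi} \<Longrightarrow> U ** hadamard_symbol k ** conjugate_transpose U =
      (\<Sum>n\<in>N. mat (exp (- \<i> * of_real k * of_int n)) ** A n)"
    using sym unfolding has_symbol_def by blast
  \<comment> \<open>Extending coefficients and amplitudes by zero makes the entry formula hold for
    every integer \<open>n\<close>, whatever \<open>N\<close> and \<open>S\<close> are.\<close>
  define B where "B n = (if n \<in> N then A n else 0)" for n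
  define f where "f g = (if g \<in> S then z g else 0)" for g
  have entries: "B n $ i $ j = f (inv\<^bsub>G\<^esub> c i \<otimes>\<^bsub>G\<^esub> a [^]\<^bsub>G\<^esub> n \<otimes>\<^bsub>G\<^esub> c j)" for n i j
    unfolding B_def f_def
    by (rule coarse_graining_coefficients[OF rep aH inj S z N R])
  have "conjugate_transpose U ** U = mat 1"
    using U by (simp add: unitary_matrix_def)
  moreover have "B n = U ** hadamard_coeff n ** conjugate_transpose U" for n
    unfolding B_def by (rule hadamard_symbol_coefficients[OF N A])
  ultimately have hadamard: "trace (B 1) = 1 / sqrt 2" "trace (B (-1)) = - (1 / sqrt 2)"
    "trace (B 1 ** B (-1)) = 1 / 2" "\<And>n. det (B n) = 0" "\<And>n. n \<noteq> 1 \<Longrightarrow> n \<noteq> -1 \<Longrightarrow> B n = 0"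
    by (rule hadamard_coeff_similar)+
  show False
    by (rule no_hadamard_amplitudes[OF rep aH gen inj entries hadamard])
qed

end
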